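(* There exists a finite relational signature $\sigma$ for which there is no algorithm that, given a sentence $\varphi \in \mathsf{FO}[\sigma]$, decides whether or not $\varphi$ is closed under disjoint unions over $\mathrm{Fin}(\sigma)$.
   Context: $\mathrm{Fin}(\sigma)$ is the class of all finite $\sigma$-structures. A sentence $\varphi$ is closed under disjoint unions over $\mathrm{Fin}(\sigma)$ if for all $A, A' \in \mathrm{Fin}(\sigma)$, $A \models \varphi$ implies $A \uplus A' \models \varphi$. *)

theory Defs
  imports "HOL-Library.Nat_Bijection"
begin

section \<open>First-order logic over finite relational structures\<close>

text \<open>A relational signature is a partial map from symbols, named by natural numbers, to arities.
  Arities are positive.\<close>

type_synonym signature = "nat \<rightharpoonup> nat"

definition finite_signature :: "signature \<Rightarrow> bool" where
  "finite_signature \<sigma> \<longleftrightarrow> finite (dom \<sigma>) \<and> 0 \<notin> ran \<sigma>"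

text \<open>Variables are named by natural numbers; equality is a logical symbol, and the remaining
  connectives and the universal quantifier are the usual abbreviations.\<close>

datatype fm =
    Eq nat nat
  | Rel nat "nat list"
  | Neg fm
  | Conj fm fm
  | Ex nat fm

fun fm_over :: "signature \<Rightarrow> fm \<Rightarrow> bool" where
  "fm_over \<sigma> (Eq x y) \<longleftrightarrow> True"
| "fm_over \<sigma> (Rel R xs) \<longleftrightarrow> \<sigma> R = Some (length xs)"
| "fm_over \<sigma> (Neg \<phi>) \<longleftrightarrow> fm_over \<sigma> \<phi>"
| "fm_over \<sigma> (Conj \<phi> \<psi>) \<longleftrightarrow> fm_over \<sigma> \<phi> \<and> fm_over \<sigma> \<psi>"
| "fm_over \<sigma> (Ex x \<phi>) \<longleftrightarrow> fm_over \<sigma> \<phi>"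

fun free_vars :: "fm \<Rightarrow> nat set" where
  "free_vars (Eq x y) = {x, y}"
| "free_vars (Rel R xs) = set xs"
| "free_vars (Neg \<phi>) = free_vars \<phi>"
| "free_vars (Conj \<phi> \<psi>) = free_vars \<phi> \<union> free_vars \<psi>"
| "free_vars (Ex x \<phi>) = free_vars \<phi> - {x}"

definition sentences :: "signature \<Rightarrow> fm set" where
  "sentences \<sigma> = {\<phi>. fm_over \<sigma> \<phi> \<and> free_vars \<phi> = {}}"

record 'a struct =
  universe :: "'a set"
  interp :: "nat \<Rightarrow> 'a list set"

text \<open>Structures are nonempty. Symbols outside the signature are interpreted by the empty set.\<close>

definition Fin :: "signature \<Rightarrow> 'a struct set" where
  "Fin \<sigma> = {A. finite (universe A) \<and> universe A \<noteq> {} \<and>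
     (\<forall>R. \<forall>as \<in> interp A R. \<sigma> R = Some (length as) \<and> set as \<subseteq> universe A)}"

fun sat :: "'a struct \<Rightarrow> (nat \<Rightarrow> 'a) \<Rightarrow> fm \<Rightarrow> bool" where
  "sat A e (Eq x y) \<longleftrightarrow> e x = e y"
| "sat A e (Rel R xs) \<longleftrightarrow> map e xs \<in> interp A R"
| "sat A e (Neg \<phi>) \<longleftrightarrow> \<not> sat A e \<phi>"
| "sat A e (Conj \<phi> \<psi>) \<longleftrightarrow> sat A e \<phi> \<and> sat A e \<psi>"
| "sat A e (Ex x \<phi>) \<longleftrightarrow> (\<exists>a \<in> universe A. sat A (e(x := a)) \<phi>)"

definition models :: "'a struct \<Rightarrow> fm \<Rightarrow> bool" (infix \<open>\<Turnstile>\<close> 50) where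
  "A \<Turnstile> \<phi> \<longleftrightarrow> (\<forall>e. range e \<subseteq> universe A \<longrightarrow> sat A e \<phi>)"

definition disjoint_union :: "'a struct \<Rightarrow> 'b struct \<Rightarrow> ('a + 'b) struct"
    (infixl \<open>\<uplus>\<close> 65) where
  "A \<uplus> B = \<lparr>universe = universe A <+> universe B,
     interp = (\<lambda>R. map Inl ` interp A R \<union> map Inr ` interp B R)\<rparr>"

text \<open>Quantification over a class of structures needs a fixed type of elements. Every finite
  structure has an isomorphic copy on natural numbers; see \<open>closed_under_disjoint_unions_any_type\<close>
  below.\<close>

definition closed_under_disjoint_unions :: "signature \<Rightarrow> fm \<Rightarrow> bool" where
  "closed_under_disjoint_unions \<sigma> \<phi> \<longleftrightarrow>
     (\<forall>(A :: nat struct) \<in> Fin \<sigma>. \<forall>(A' :: nat struct) \<in> Fin \<sigma>. A \<Turnstile> \<phi> \<longrightarrow> A \<uplus> A' \<Turnstile> \<phi>)"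

definition iso_by :: "('a \<Rightarrow> 'b) \<Rightarrow> 'a struct \<Rightarrow> 'b struct \<Rightarrow> bool" where
  "iso_by h A B \<longleftrightarrow> bij_betw h (universe A) (universe B) \<and>
     (\<forall>R as. set as \<subseteq> universe A \<longrightarrow> (map h as \<in> interp B R \<longleftrightarrow> as \<in> interp A R))"

lemma sat_iso:
  assumes "iso_by h A B" "range e \<subseteq> universe A"
  shows "sat B (h \<circ> e) \<phi> \<longleftrightarrow> sat A e \<phi>"
  using assms(2)
proof (induction \<phi> arbitrary: e)
  case (Eq x y)
  then have "e x \<in> universe A" "e y \<in> universe A" by auto
  then show ?case using assms(1)
    by (auto simp: iso_by_def bij_betw_def inj_on_def)
next
  case (Rel R xs)
  have "set (map e xs) \<subseteq> universe A" using Rel by auto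
  then have "map h (map e xs) \<in> interp B R \<longleftrightarrow> map e xs \<in> interp A R"
    using assms(1) unfolding iso_by_def by blast
  then show ?case by (simp add: comp_def)
next
  case (Ex x \<phi>)
  have img: "universe B = h ` universe A"
    using assms(1) by (simp add: iso_by_def bij_betw_def)
  have "sat B ((h \<circ> e)(x := h a)) \<phi> \<longleftrightarrow> sat A (e(x := a)) \<phi>" if "a \<in> universe A" for a
  proof -
    have "range (e(x := a)) \<subseteq> universe A" using Ex.prems that by auto
    from Ex.IH[OF this] show ?thesis by (simp only: fun_upd_comp)
  qed
  then show ?case by (simp add: img comp_def)
qed simp_all

lemma models_iso:
  assumes "iso_by h A B"
  shows "B \<Turnstile> \<phi> \<longleftrightarrow> A \<Turnstile> \<phi>"
proof
  assume B: "B \<Turnstile> \<phi>"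
  show "A \<Turnstile> \<phi>" unfolding models_def
  proof (intro allI impI)
    fix e :: "nat \<Rightarrow> 'a" assume e: "range e \<subseteq> universe A"
    then have "range (h \<circ> e) \<subseteq> universe B"
      using assms by (auto simp: iso_by_def bij_betw_def)
    then show "sat A e \<phi>" using B sat_iso[OF assms e] unfolding models_def by blast
  qed
next
  assume A: "A \<Turnstile> \<phi>"
  show "B \<Turnstile> \<phi>" unfolding models_def
  proof (intro allI impI)
    fix e :: "nat \<Rightarrow> 'b" assume e: "range e \<subseteq> universe B"
    define e' where "e' = inv_into (universe A) h \<circ> e"
    have img: "h ` universe A = universe B"
      using assms by (simp add: iso_by_def bij_betw_def)
    have e': "range e' \<subseteq> universe A"
      using e img by (auto simp: e'_def intro!: inv_into_into)
    have "h (e' x) = e x" for x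
      using e img unfolding e'_def by (auto intro!: f_inv_into_f)
    then have "h \<circ> e' = e" by auto
    then show "sat B e \<phi>" using A e' sat_iso[OF assms e'] unfolding models_def by metis
  qed
qed

lemma iso_byI:
  assumes inj: "inj_on h (universe A)"
    and img: "universe B = h ` universe A" "\<And>R. interp B R = map h ` interp A R"
    and sub: "\<And>R as. as \<in> interp A R \<Longrightarrow> set as \<subseteq> universe A"
  shows "iso_by h A B"
  unfolding iso_by_def
proof (intro conjI allI impI)
  show "bij_betw h (universe A) (universe B)"
    using inj img(1) by (simp add: bij_betw_def)
next
  fix R as assume as: "set as \<subseteq> universe A"
  have "as \<in> interp A R" if "map h as = map h bs" "bs \<in> interp A R" for bs
  proof -
    have "set as \<union> set bs \<subseteq> universe A" using as sub[OF that(2)] by blast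
    then have "as = bs"
      using map_inj_on[OF that(1)] inj_on_subset[OF inj] by blast
    with that(2) show ?thesis by simp
  qed
  then show "map h as \<in> interp B R \<longleftrightarrow> as \<in> interp A R"
    unfolding img(2) by blast
qed

lemma Fin_nat_copy:
  assumes "A \<in> Fin \<sigma>"
  obtains h and B :: "nat struct" where "B \<in> Fin \<sigma>" "iso_by h A B"
    "\<And>R. interp B R = map h ` interp A R"
proof -
  have A: "finite (universe A)" "universe A \<noteq> {}"
    "\<And>R as. as \<in> interp A R \<Longrightarrow> \<sigma> R = Some (length as) \<and> set as \<subseteq> universe A"
    using assms by (auto simp: Fin_def)
  obtain h :: "'a \<Rightarrow> nat" where inj: "inj_on h (universe A)"
    using finite_imp_inj_to_nat_seg[OF A(1)] by blast
  define B where "B = \<lparr>universe = h ` universe A, interp = (\<lambda>R. map h ` interp A R)\<rparr>"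
  have "\<sigma> R = Some (length bs) \<and> set bs \<subseteq> universe B" if bs: "bs \<in> interp B R" for R bs
  proof -
    obtain as where "bs = map h as" "as \<in> interp A R" using bs by (auto simp: B_def)
    then show ?thesis using A(3)[of as R] by (simp add: B_def image_mono)
  qed
  then have "B \<in> Fin \<sigma>"
    using A(1,2) by (simp add: Fin_def B_def)
  moreover have "iso_by h A B"
    by (rule iso_byI) (use inj A(3) in \<open>simp_all add: B_def\<close>)
  ultimately show thesis by (rule that) (simp add: B_def)
qed

lemma iso_by_disjoint_union:
  assumes h: "iso_by h A B" and k: "iso_by k A' B'"
    and AB: "A \<in> Fin \<sigma>" "A' \<in> Fin \<sigma>"
    and int: "\<And>R. interp B R = map h ` interp A R" "\<And>R. interp B' R = map k ` interp A' R"
  shows "iso_by (map_sum h k) (A \<uplus> A') (B \<uplus> B')"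
proof (rule iso_byI)
  have "inj_on h (universe A)" "inj_on k (universe A')"
    using h k by (simp_all add: iso_by_def bij_betw_def)
  then show "inj_on (map_sum h k) (universe (A \<uplus> A'))"
    by (auto simp: disjoint_union_def intro!: inj_onI dest: inj_onD)
  have "universe B = h ` universe A" "universe B' = k ` universe A'"
    using h k by (simp_all add: iso_by_def bij_betw_def)
  then show "universe (B \<uplus> B') = map_sum h k ` universe (A \<uplus> A')"
    by (simp add: disjoint_union_def Plus_def image_Un image_image)
  show "interp (B \<uplus> B') R = map (map_sum h k) ` interp (A \<uplus> A') R" for R
    by (simp add: disjoint_union_def int image_Un image_image comp_def)
  show "set as \<subseteq> universe (A \<uplus> A')" if as: "as \<in> interp (A \<uplus> A') R" for R as
  proof -
    consider bs where "as = map Inl bs" "bs \<in> interp A R"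
      | bs where "as = map Inr bs" "bs \<in> interp A' R"
      using as by (auto simp: disjoint_union_def)
    then show ?thesis
    proof cases
      case (1 bs)
      then have "set bs \<subseteq> universe A" using AB(1) by (simp add: Fin_def)
      then show ?thesis using 1(1) by (auto simp: disjoint_union_def)
    next
      case (2 bs)
      then have "set bs \<subseteq> universe A'" using AB(2) by (simp add: Fin_def)
      then show ?thesis using 2(1) by (auto simp: disjoint_union_def)
    qed
  qed
qed

lemma closed_under_disjoint_unions_any_type:
  fixes A :: "'a struct" and A' :: "'b struct"
  assumes "closed_under_disjoint_unions \<sigma> \<phi>" "A \<in> Fin \<sigma>" "A' \<in> Fin \<sigma>" "A \<Turnstile> \<phi>"
  shows "A \<uplus> A' \<Turnstile> \<phi>"
proof -
  obtain h and B :: "nat struct" where B: "B \<in> Fin \<sigma>" "iso_by h A B"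
    "\<And>R. interp B R = map h ` interp A R" by (rule Fin_nat_copy[OF assms(2)]) (rule that)
  obtain k and B' :: "nat struct" where B': "B' \<in> Fin \<sigma>" "iso_by k A' B'"
    "\<And>R. interp B' R = map k ` interp A' R" by (rule Fin_nat_copy[OF assms(3)]) (rule that)
  have "B \<Turnstile> \<phi>"
    using assms(4) by (simp only: models_iso[OF B(2)])
  then have "B \<uplus> B' \<Turnstile> \<phi>"
    using assms(1) B(1) B'(1) by (simp add: closed_under_disjoint_unions_def)
  then show ?thesis
    by (simp only: models_iso[OF iso_by_disjoint_union[OF B(2) B'(2) assms(2,3) B(3) B'(3)]])
qed


section \<open>Algorithms on formulas\<close>

text \<open>Algorithms are programs for partial recursive functions on the natural numbers.
  \<open>computes p xs y\<close> means that \<open>p\<close> halts on input \<open>xs\<close> with output \<open>y\<close>. \<open>PrimRec\<close> recurses on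
  its first argument, and \<open>Mu\<close> searches for the least zero in the first argument of its body,
  which must be defined on all smaller values.\<close>

datatype prog =
    Zero
  | Succ
  | Proj nat
  | Comp prog "prog list"
  | PrimRec prog prog
  | Mu prog

inductive computes :: "prog \<Rightarrow> nat list \<Rightarrow> nat \<Rightarrow> bool" where
  Zero: "computes Zero xs 0"
| Succ: "computes Succ [x] (Suc x)"
| Proj: "i < length xs \<Longrightarrow> computes (Proj i) xs (xs ! i)"
| Comp: "list_all2 (\<lambda>q y. computes q xs y) qs ys \<Longrightarrow> computes p ys z
    \<Longrightarrow> computes (Comp p qs) xs z"
| PrimRec_0: "computes p xs y \<Longrightarrow> computes (PrimRec p q) (0 # xs) y"
| PrimRec_Suc: "computes (PrimRec p q) (n # xs) y \<Longrightarrow> computes q (n # y # xs) z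
    \<Longrightarrow> computes (PrimRec p q) (Suc n # xs) z"
| Mu: "computes p (n # xs) 0 \<Longrightarrow> (\<forall>m<n. \<exists>y>0. computes p (m # xs) y)
    \<Longrightarrow> computes (Mu p) xs n"

lemma computes_deterministic:
  "computes p xs y \<Longrightarrow> computes p xs y' \<Longrightarrow> y' = y"
proof (induction arbitrary: y' rule: computes.induct)
  case (Comp xs qs ys p z)
  from Comp.prems obtain ys' where
    ys': "list_all2 (\<lambda>q y. computes q xs y) qs ys'" "computes p ys' y'"
    by (cases rule: computes.cases) auto
  have "ys' = ys"
    using Comp.IH(1) ys'(1) by (auto simp: list_all2_conv_all_nth intro!: nth_equalityI)
  then show ?case using Comp.IH(2) ys'(2) by blast
next
  case (PrimRec_Suc p q n xs y z)
  from PrimRec_Suc.prems obtain r where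
    "computes (PrimRec p q) (n # xs) r" "computes q (n # r # xs) y'"
    by (cases rule: computes.cases) auto
  then show ?case using PrimRec_Suc.IH by blast
next
  case (Mu p n xs)
  from Mu.prems have
    n': "computes p (y' # xs) 0" "\<forall>m<y'. \<exists>y>0. computes p (m # xs) y"
    by (cases rule: computes.cases; simp)+
  have "\<not> n < y'" using n'(2) Mu.IH(1) by fastforce
  moreover have "\<not> y' < n" using n'(1) Mu.IH(2) by fastforce
  ultimately show ?case by simp
next
  case (Zero xs)
  then show ?case by (cases rule: computes.cases) simp
next
  case (Succ x)
  then show ?case by (cases rule: computes.cases) simp
next
  case (Proj i xs)
  from Proj.prems show ?case by (cases rule: computes.cases) simp
next
  case (PrimRec_0 p xs y q)
  from PrimRec_0.prems have "computes p xs y'" by (cases rule: computes.cases) simp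
  then show ?case by (rule PrimRec_0.IH)
qed

text \<open>Formulas are given to algorithms by their Goedel numbers.\<close>

fun fm_encode :: "fm \<Rightarrow> nat" where
  "fm_encode (Eq x y) = prod_encode (0, prod_encode (x, y))"
| "fm_encode (Rel R xs) = prod_encode (1, prod_encode (R, list_encode xs))"
| "fm_encode (Neg \<phi>) = prod_encode (2, fm_encode \<phi>)"
| "fm_encode (Conj \<phi> \<psi>) = prod_encode (3, prod_encode (fm_encode \<phi>, fm_encode \<psi>))"
| "fm_encode (Ex x \<phi>) = prod_encode (4, prod_encode (x, fm_encode \<phi>))"

lemma fm_encode_inject: "fm_encode \<phi> = fm_encode \<psi> \<longleftrightarrow> \<phi> = \<psi>"
proof (induction \<phi> arbitrary: \<psi>)
  case (Eq x y) then show ?case by (cases \<psi>) auto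
next
  case (Rel R xs) then show ?case by (cases \<psi>) (auto dest: injD[OF inj_list_encode])
next
  case (Neg \<phi>) then show ?case by (cases \<psi>) auto
next
  case (Conj \<phi>1 \<phi>2) then show ?case by (cases \<psi>) auto
next
  case (Ex x \<phi>) then show ?case by (cases \<psi>) auto
qed

text \<open>The decision problem for \<open>P\<close> on instances \<open>S\<close>: nothing is required of the program on
  numbers that do not encode an element of \<open>S\<close>.\<close>

definition decides :: "prog \<Rightarrow> fm set \<Rightarrow> (fm \<Rightarrow> bool) \<Rightarrow> bool" where
  "decides p S P \<longleftrightarrow> (\<forall>\<phi> \<in> S. computes p [fm_encode \<phi>] (if P \<phi> then 1 else 0))"

end

theory Submission
  imports Defs Complex_Main
begin

text \<open>The signature has a binary symbol for a linear order and a ternary symbol for tables of values.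
  A finite linear order is an initial segment of the natural numbers, and the graph of a program
  can be described in it by a formula: in every finite linear order the formula is true only of
  genuine computations, and every computation is recognised by all large enough structures whose
  elements code finite tables. Given a program \<open>p\<close> for the decision problem, diagonalization yields
  a sentence that says of its own Goedel number that \<open>p\<close> halts on it with a nonzero output, together
  with the axioms of linear orders. A disjoint union of two structures is never linearly ordered, so
  the sentence is closed under disjoint unions iff it has no finite model, which happens iff \<open>p\<close>
  denies that it is closed.\<close>

section \<open>Total computable functions\<close>

text \<open>Arguments arrive as one list of fixed length, so that expressions in
  \<open>xs ! i\<close> can be assembled by introduction rules instead of writing programs.\<close>

definition computable :: "nat \<Rightarrow> (nat list \<Rightarrow> nat) \<Rightarrow> bool" where
  "computable k f \<longleftrightarrow> (\<exists>p. \<forall>xs. length xs = k \<longrightarrow> computes p xs (f xs))"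

lemma computable_proj: "i < k \<Longrightarrow> computable k (\<lambda>xs. xs ! i)"
  unfolding computable_def by (metis computes.Proj)

lemma computable_Suc:
  assumes "computable k f"
  shows "computable k (\<lambda>xs. Suc (f xs))"
proof -
  obtain p where "\<And>xs. length xs = k \<Longrightarrow> computes p xs (f xs)"
    using assms unfolding computable_def by blast
  then have "computes (Comp Succ [p]) xs (Suc (f xs))" if "length xs = k" for xs
    using that by (auto intro!: computes.Comp[of _ _ "[f xs]"] computes.Succ)
  then show ?thesis unfolding computable_def by blast
qed

lemma computable_const: "computable k (\<lambda>xs. n)"
proof (induction n)
  case 0
  then show ?case unfolding computable_def by (metis computes.Zero)
qed (rule computable_Suc)

lemma computable_comp2:
  assumes "computable 2 (\<lambda>xs. g (xs ! 0) (xs ! 1))" "computable k f1" "computable k f2"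
  shows "computable k (\<lambda>xs. g (f1 xs) (f2 xs))"
proof -
  obtain p p1 p2 where p: "\<And>xs. length xs = 2 \<Longrightarrow> computes p xs (g (xs ! 0) (xs ! 1))"
    and p1: "\<And>xs. length xs = k \<Longrightarrow> computes p1 xs (f1 xs)"
    and p2: "\<And>xs. length xs = k \<Longrightarrow> computes p2 xs (f2 xs)"
    using assms unfolding computable_def by blast
  have "computes (Comp p [p1, p2]) xs (g (f1 xs) (f2 xs))" if "length xs = k" for xs
    using p1[OF that] p2[OF that] p[of "[f1 xs, f2 xs]"]
    by (auto intro!: computes.Comp[of _ _ "[f1 xs, f2 xs]"])
  then show ?thesis unfolding computable_def by blast
qed

lemma computable_primrec:
  assumes "computable k a" "computable (Suc (Suc k)) g"
    and f: "\<And>ys. f 0 ys = a ys" "\<And>n ys. f (Suc n) ys = g (n # f n ys # ys)"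
  shows "computable (Suc k) (\<lambda>xs. f (hd xs) (tl xs))"
proof -
  obtain p q where p: "\<And>xs. length xs = k \<Longrightarrow> computes p xs (a xs)"
    and q: "\<And>xs. length xs = Suc (Suc k) \<Longrightarrow> computes q xs (g xs)"
    using assms unfolding computable_def by blast
  have "computes (PrimRec p q) (n # ys) (f n ys)" if "length ys = k" for n ys
  proof (induction n)
    case 0
    show ?case by (simp add: f computes.PrimRec_0 p that)
  next
    case (Suc n)
    then show ?case using computes.PrimRec_Suc f(2) q that by simp
  qed
  then have "computes (PrimRec p q) xs (f (hd xs) (tl xs))" if "length xs = Suc k" for xs
    using that by (cases xs) auto
  then show ?thesis unfolding computable_def by blast
qed

text \<open>Without parameters the base value \<open>f 0\<close> is a single number, hence
  computable as a constant; only the step function has to be supplied.\<close>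

lemma computable_primrec1:
  assumes "computable 2 (\<lambda>xs. g (xs ! 0) (xs ! 1))" "\<And>n. f (Suc n) = g n (f n)"
  shows "computable 1 (\<lambda>xs. f (xs ! 0))"
proof -
  have "computable (Suc 0) (\<lambda>xs. f (hd xs))"
    by (rule computable_primrec[where f = "\<lambda>n _. f n" and a = "\<lambda>_. f 0"
          and g = "\<lambda>xs. g (xs ! 0) (xs ! 1)"])
      (use assms in \<open>simp_all add: computable_const numeral_2_eq_2\<close>)
  moreover have "hd xs = xs ! 0" if "length xs = Suc 0" for xs :: "nat list"
    using that by (cases xs) auto
  ultimately show ?thesis unfolding computable_def by (metis One_nat_def)
qed

lemma computable_add:
  assumes "computable k f" "computable k g"
  shows "computable k (\<lambda>xs. f xs + g xs)"
proof -
  have "computable (Suc 1) (\<lambda>xs. hd xs + tl xs ! 0)"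
    by (rule computable_primrec[where f = "\<lambda>n ys. n + ys ! 0" and a = "\<lambda>ys. ys ! 0"
          and g = "\<lambda>xs. Suc (xs ! 1)"])
      (simp_all add: computable_Suc computable_proj)
  moreover have "hd xs + tl xs ! 0 = xs ! 0 + xs ! 1" if "length xs = 2" for xs :: "nat list"
    using that by (cases xs) auto
  ultimately have "computable 2 (\<lambda>xs. xs ! 0 + xs ! 1)"
    unfolding computable_def by (metis Suc_1)
  from computable_comp2[OF this assms] show ?thesis .
qed

text \<open>The Cantor pairing of m and n is \<open>triangle (m + n) + m\<close>, and
  \<open>triangle\<close> is primitive recursive: its value at \<open>Suc n\<close> adds
  \<open>Suc n\<close> to its value at \<open>n\<close>.\<close>

lemma computable_prod_encode:
  assumes "computable k f" "computable k g"
  shows "computable k (\<lambda>xs. prod_encode (f xs, g xs))"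
proof -
  have "computable 1 (\<lambda>xs. triangle (xs ! 0))"
    by (rule computable_primrec1[where g = "\<lambda>n r. r + Suc n"])
      (simp_all add: computable_add computable_Suc computable_proj)
  then obtain p where p: "\<And>xs. length xs = 1 \<Longrightarrow> computes p xs (triangle (xs ! 0))"
    unfolding computable_def by blast
  obtain q where q: "\<And>xs. length xs = k \<Longrightarrow> computes q xs (f xs + g xs)"
    using computable_add[OF assms] unfolding computable_def by blast
  have "computes (Comp p [q]) xs (triangle (f xs + g xs))" if "length xs = k" for xs
    using q[OF that] p[of "[f xs + g xs]"]
    by (auto intro!: computes.Comp[of _ _ "[f xs + g xs]"])
  then have "computable k (\<lambda>xs. triangle (f xs + g xs))"
    unfolding computable_def by blast
  from computable_add[OF this assms(1)] show ?thesis
    by (simp add: prod_encode_def)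
qed

section \<open>Finite linear orders\<close>

abbreviation disj_fm :: "fm \<Rightarrow> fm \<Rightarrow> fm" where
  "disj_fm \<phi> \<psi> \<equiv> Neg (Conj (Neg \<phi>) (Neg \<psi>))"

abbreviation imp_fm :: "fm \<Rightarrow> fm \<Rightarrow> fm" where
  "imp_fm \<phi> \<psi> \<equiv> Neg (Conj \<phi> (Neg \<psi>))"

abbreviation all_fm :: "nat \<Rightarrow> fm \<Rightarrow> fm" where
  "all_fm x \<phi> \<equiv> Neg (Ex x (Neg \<phi>))"

abbreviation less_fm :: "nat \<Rightarrow> nat \<Rightarrow> fm" where
  "less_fm x y \<equiv> Rel 0 [x, y]"

abbreviation entry_fm :: "nat \<Rightarrow> nat \<Rightarrow> nat \<Rightarrow> fm" where
  "entry_fm s i v \<equiv> Rel 1 [s, i, v]"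

definition order_sig :: signature where
  "order_sig = [0 \<mapsto> 2, 1 \<mapsto> 3]"

lemma order_sig_simps [simp]: "order_sig 0 = Some 2" "order_sig (Suc 0) = Some 3"
  by (simp_all add: order_sig_def)

definition linorder_fm :: fm where
  "linorder_fm = Conj (all_fm 0 (Neg (less_fm 0 0)))
     (Conj (all_fm 0 (all_fm 1 (disj_fm (Eq 0 1) (disj_fm (less_fm 0 1) (less_fm 1 0)))))
       (all_fm 0 (all_fm 1 (all_fm 2 (imp_fm (Conj (less_fm 0 1) (less_fm 1 2)) (less_fm 0 2))))))"

lemma sat_linorder_fm:
  "sat A e linorder_fm \<longleftrightarrow>
     (\<forall>x\<in>universe A. [x, x] \<notin> interp A 0) \<and>
     (\<forall>x\<in>universe A. \<forall>y\<in>universe A. x = y \<or> [x, y] \<in> interp A 0 \<or> [y, x] \<in> interp A 0) \<and>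
     (\<forall>x\<in>universe A. \<forall>y\<in>universe A. \<forall>z\<in>universe A.
        [x, y] \<in> interp A 0 \<longrightarrow> [y, z] \<in> interp A 0 \<longrightarrow> [x, z] \<in> interp A 0)"
  by (auto simp: linorder_fm_def)

text \<open>Formulas have named variables and no renaming, so the caller supplies \<open>k\<close>
  as the name of the bound variable, here and in \<open>succ_fm\<close>.\<close>

definition zero_fm :: "nat \<Rightarrow> nat \<Rightarrow> fm" where
  "zero_fm x k = Neg (Ex k (less_fm k x))"

definition succ_fm :: "nat \<Rightarrow> nat \<Rightarrow> nat \<Rightarrow> fm" where
  "succ_fm x y k = Conj (less_fm x y) (Neg (Ex k (Conj (less_fm x k) (less_fm k y))))"

text \<open>Elements are read as numbers through their ranks. By \<open>rank_image\<close> the ranks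
  have no gaps, so least elements and immediate successors express 0 and \<open>Suc\<close>. The
  table symbol 1 stays arbitrary.\<close>

locale ranked =
  fixes A :: "'a struct" and rank :: "'a \<Rightarrow> nat"
  assumes less_iff: "x \<in> universe A \<Longrightarrow> y \<in> universe A \<Longrightarrow> [x, y] \<in> interp A 0 \<longleftrightarrow> rank x < rank y"
    and rank_image: "rank ` universe A = {..<card (universe A)}"
begin

lemma below_rank:
  assumes "x \<in> universe A" "n < rank x"
  obtains y where "y \<in> universe A" "rank y = n"
proof -
  have "rank x < card (universe A)" using assms(1) rank_image by auto
  then have "n \<in> rank ` universe A" using assms(2) rank_image by simp
  then show thesis using that by auto
qed

lemma sat_zero_fm:
  assumes "e x \<in> universe A" "x \<noteq> k"
  shows "sat A e (zero_fm x k) \<longleftrightarrow> rank (e x) = 0"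
proof -
  have "rank (e x) = 0" if "\<forall>a\<in>universe A. \<not> rank a < rank (e x)"
  proof (rule ccontr)
    assume pos: "rank (e x) \<noteq> 0"
    then obtain y where "y \<in> universe A" "rank y = 0" using below_rank[OF assms(1), of 0] by auto
    then show False using that pos by auto
  qed
  then show ?thesis using assms by (auto simp: zero_fm_def less_iff)
qed

lemma sat_succ_fm:
  assumes "e x \<in> universe A" "e y \<in> universe A" "x \<noteq> k" "y \<noteq> k"
  shows "sat A e (succ_fm x y k) \<longleftrightarrow> rank (e y) = Suc (rank (e x))"
proof -
  have "rank (e y) = Suc (rank (e x))"
    if "rank (e x) < rank (e y)" "\<forall>a\<in>universe A. rank (e x) < rank a \<longrightarrow> \<not> rank a < rank (e y)"
  proof (rule ccontr)
    assume "rank (e y) \<noteq> Suc (rank (e x))"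
    then have gap: "Suc (rank (e x)) < rank (e y)" using that(1) by simp
    obtain z where "z \<in> universe A" "rank z = Suc (rank (e x))"
      using below_rank[OF assms(2) gap] .
    then show False using that(2) gap by auto
  qed
  then show ?thesis using assms by (auto simp: succ_fm_def less_iff)
qed

end

text \<open>The rank of an element is the number of its predecessors. It is strictly monotone, hence
  injective, and smaller than the cardinality, so by counting its values fill the initial
  segment.\<close>

lemma ranked_linorder:
  assumes "finite (universe A)" "sat A e linorder_fm"
  obtains rank where "ranked A rank"
proof
  let ?L = "\<lambda>x y. [x, y] \<in> interp A 0"
  let ?r = "\<lambda>x. card {y \<in> universe A. ?L y x}"
  have irr: "\<And>x. x \<in> universe A \<Longrightarrow> \<not> ?L x x"
    and total: "\<And>x y. x \<in> universe A \<Longrightarrow> y \<in> universe A \<Longrightarrow> x = y \<or> ?L x y \<or> ?L y x"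
    and trans: "\<And>x y z. x \<in> universe A \<Longrightarrow> y \<in> universe A \<Longrightarrow> z \<in> universe A
      \<Longrightarrow> ?L x y \<Longrightarrow> ?L y z \<Longrightarrow> ?L x z"
    using assms(2) unfolding sat_linorder_fm by blast+
  have mono: "?r x < ?r y" if "x \<in> universe A" "y \<in> universe A" "?L x y" for x y
  proof (rule psubset_card_mono)
    have "x \<notin> {z \<in> universe A. ?L z x}" "x \<in> {z \<in> universe A. ?L z y}"
      using irr that by auto
    moreover have "{z \<in> universe A. ?L z x} \<subseteq> {z \<in> universe A. ?L z y}"
      using trans that by blast
    ultimately show "{z \<in> universe A. ?L z x} \<subset> {z \<in> universe A. ?L z y}" by blast
  qed (use assms(1) in simp)
  have less: "?L x y \<longleftrightarrow> ?r x < ?r y" if "x \<in> universe A" "y \<in> universe A" for x y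
  proof
    assume "?r x < ?r y"
    then show "?L x y" using total[OF that] mono[OF that(2,1)] by auto
  qed (rule mono[OF that])
  have "?r x < card (universe A)" if "x \<in> universe A" for x
  proof (rule psubset_card_mono)
    show "{y \<in> universe A. ?L y x} \<subset> universe A" using irr[OF that] that by blast
  qed (rule assms(1))
  then have sub: "?r ` universe A \<subseteq> {..<card (universe A)}" by auto
  have "inj_on ?r (universe A)"
  proof (rule inj_onI)
    fix x y assume xy: "x \<in> universe A" "y \<in> universe A" "?r x = ?r y"
    then show "x = y" using total[OF xy(1,2)] mono[OF xy(1,2)] mono[OF xy(2,1)] by auto
  qed
  then have "card (?r ` universe A) = card (universe A)" by (rule card_image)
  then have "?r ` universe A = {..<card (universe A)}"
    using sub by (intro card_subset_eq) auto
  then show "ranked A ?r" using less by unfold_locales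
qed

section \<open>Formulas for graphs of programs\<close>

text \<open>The variables from \<open>k\<close> on are fresh. In the formula for \<open>PrimRec\<close>, variable \<open>k\<close> denotes a set
  of pairs (index, value) each of which is justified by a pair of the set with the preceding index.\<close>

function (sequential) graph_fm :: "prog \<Rightarrow> nat list \<Rightarrow> nat \<Rightarrow> nat \<Rightarrow> fm"
  and comp_fm :: "prog list \<Rightarrow> prog \<Rightarrow> nat list \<Rightarrow> nat list \<Rightarrow> nat \<Rightarrow> nat \<Rightarrow> fm" where
  "graph_fm Zero xs y k = zero_fm y k"
| "graph_fm Succ xs y k = (case xs of [x] \<Rightarrow> succ_fm x y k | _ \<Rightarrow> Neg (Eq y y))"
| "graph_fm (Proj i) xs y k = (if i < length xs then Eq (xs ! i) y else Neg (Eq y y))"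
| "graph_fm (Comp p qs) xs y k = comp_fm qs p [] xs y k"
| "graph_fm (PrimRec p q) xs y k = (case xs of [] \<Rightarrow> Neg (Eq y y) | n # ns \<Rightarrow>
     Ex k (Conj (entry_fm k n y) (all_fm (k+1) (all_fm (k+2) (imp_fm (entry_fm k (k+1) (k+2))
       (disj_fm (Conj (zero_fm (k+1) (k+3)) (graph_fm p ns (k+2) (k+3)))
         (Ex (k+3) (Ex (k+4) (Conj (succ_fm (k+3) (k+1) (k+5))
           (Conj (entry_fm k (k+3) (k+4))
             (graph_fm q ((k+3) # (k+4) # ns) (k+2) (k+5))))))))))))"
| "graph_fm (Mu p) xs y k =
     Ex k (Conj (zero_fm k (k+1)) (Conj (graph_fm p (y # xs) k (k+1))
       (all_fm (k+1) (imp_fm (less_fm (k+1) y)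
         (Ex (k+2) (Conj (Ex (k+3) (less_fm (k+3) (k+2)))
           (graph_fm p ((k+1) # xs) (k+2) (k+3))))))))"
| "comp_fm [] p zs xs y k = graph_fm p zs y k"
| "comp_fm (q # qs) p zs xs y k =
     Ex k (Conj (graph_fm q xs k (k+1)) (comp_fm qs p (zs @ [k]) xs y (k+1)))"
  by pat_completeness auto
termination
  \<comment> \<open>Doubling leaves room for the odd weight of \<open>comp_fm\<close>, which must
    lie strictly between those of \<open>Comp p qs\<close> and \<open>p\<close>.\<close>
  by (relation "measure (case_sum (\<lambda>(p, _). 2 * size p)
      (\<lambda>(qs, p, _). Suc (2 * (size p + size_list size qs))))") auto

lemma graph_fm_over:
  "fm_over order_sig (graph_fm p xs y k)"
  "fm_over order_sig (comp_fm qs p zs xs y k)"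
proof (induction p xs y k and qs p zs xs y k rule: graph_fm_comp_fm.induct)
  case (5 p q xs y k)
  then show ?case by (cases xs) (simp_all add: zero_fm_def succ_fm_def)
qed (simp_all add: zero_fm_def succ_fm_def split: list.split)

lemma free_vars_graph_fm:
  "free_vars (graph_fm p xs y k) \<subseteq> insert y (set xs)"
  "free_vars (comp_fm qs p zs xs y k) \<subseteq> insert y (set xs \<union> set zs)"
proof (induction p xs y k and qs p zs xs y k rule: graph_fm_comp_fm.induct)
  case (2 xs y k)
  show ?case by (auto simp: succ_fm_def split: list.split)
next
  case (5 p q xs y k)
  show ?case
  proof (cases xs)
    case (Cons n ns)
    note IH = 5[OF Cons]
    show ?thesis using IH by (simp add: Cons zero_fm_def succ_fm_def) blast
  qed simp
next
  case (6 p xs y k)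
  then show ?case by (simp add: zero_fm_def) blast
next
  case (8 q qs p zs xs y k)
  then show ?case by simp blast
qed (auto simp: zero_fm_def)

section \<open>Soundness of graph formulas in finite linear orders\<close>

context ranked
begin

text \<open>A table may contain entries of any origin, but the formula demands a justification for
  each of them, and chains of justifications descend to index 0. In the second claim
  \<open>ls\<close> holds the outputs of the components already evaluated.\<close>

lemma graph_fm_sound:
  "range e \<subseteq> universe A \<Longrightarrow> \<forall>x\<in>set xs. x < k \<Longrightarrow> y < k \<Longrightarrow> sat A e (graph_fm p xs y k)
    \<Longrightarrow> ms = map (\<lambda>x. rank (e x)) xs \<Longrightarrow> r = rank (e y) \<Longrightarrow> computes p ms r"
  "range e \<subseteq> universe A \<Longrightarrow> \<forall>x\<in>set xs. x < k \<Longrightarrow> \<forall>x\<in>set zs. x < k \<Longrightarrow> y < k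
    \<Longrightarrow> sat A e (comp_fm qs p zs xs y k)
    \<Longrightarrow> ms = map (\<lambda>x. rank (e x)) xs \<Longrightarrow> ls = map (\<lambda>x. rank (e x)) zs \<Longrightarrow> r = rank (e y)
    \<Longrightarrow> \<exists>ys. list_all2 (\<lambda>q. computes q ms) qs ys \<and> computes p (ls @ ys) r"
proof (induction p xs y k and qs p zs xs y k arbitrary: e ms r and e ms ls r
    rule: graph_fm_comp_fm.induct)
  case (1 xs y k)
  then have "rank (e y) = 0" by (simp add: sat_zero_fm image_subset_iff)
  then show ?case using 1(6) by (simp add: computes.Zero)
next
  case (2 xs y k)
  then obtain x where "xs = [x]" by (auto split: list.splits)
  with 2 have "rank (e y) = Suc (rank (e x))" by (simp add: sat_succ_fm image_subset_iff)
  then show ?case using \<open>xs = [x]\<close> 2(5,6) by (simp add: computes.Succ)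
next
  case (3 i xs y k)
  then have "i < length ms" "r = ms ! i" by (auto split: if_splits)
  then show ?case by (simp add: computes.Proj)
next
  case (4 p qs xs y k)
  have "\<exists>ys. list_all2 (\<lambda>q. computes q ms) qs ys \<and> computes p ([] @ ys) r"
    by (rule "4.IH"[OF 4(2,3) _ 4(4) _ 4(6) _ 4(7)]) (use 4(5) in simp_all)
  then obtain ys where "list_all2 (\<lambda>q. computes q ms) qs ys" "computes p ys r" by auto
  then show ?case by (rule computes.Comp)
next
  case (5 p q xs y k)
  then obtain n ns where xs: "xs = n # ns" by (auto split: list.splits)
  have U: "\<And>x. e x \<in> universe A" using 5(3) by auto
  have fresh: "\<forall>x\<in>set ns. x < k" "n < k" using 5(4) xs by auto
  define ls where "ls = map (\<lambda>x. rank (e x)) ns"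
  from 5(6) xs fresh(2) \<open>y < k\<close> obtain s where s: "s \<in> universe A" "[s, e n, e y] \<in> interp A 1"
    and just: "\<And>i v. i \<in> universe A \<Longrightarrow> v \<in> universe A \<Longrightarrow> [s, i, v] \<in> interp A 1 \<Longrightarrow>
      (let e' = e(k := s, k+1 := i, k+2 := v) in
       sat A e' (zero_fm (k+1) (k+3)) \<and> sat A e' (graph_fm p ns (k+2) (k+3)) \<or>
       (\<exists>j\<in>universe A. \<exists>u\<in>universe A. let e'' = e'(k+3 := j, k+4 := u) in
         sat A e'' (succ_fm (k+3) (k+1) (k+5)) \<and> [s, j, u] \<in> interp A 1
         \<and> sat A e'' (graph_fm q ((k+3) # (k+4) # ns) (k+2) (k+5))))"
    by (auto simp: Let_def)
  \<comment> \<open>Claimed for every entry of the table and not only for the one at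
    \<open>n\<close>, so that induction on the rank of the index can pass to the justifying
    entry.\<close>
  have "computes (PrimRec p q) (rank i # ls) (rank v)"
    if "i \<in> universe A" "v \<in> universe A" "[s, i, v] \<in> interp A 1" for i v
    using that
  proof (induction "rank i" arbitrary: i v)
    case 0
    let ?e = "e(k := s, k+1 := i, k+2 := v)"
    have U': "range ?e \<subseteq> universe A" using U s(1) 0 by auto
    \<comment> \<open>An index of rank 0 is no successor, which leaves the first disjunct of
      \<open>just\<close>; a positive rank leaves the second.\<close>
    from 0 have sat: "sat A ?e (graph_fm p ns (k+2) (k+3))"
      using just[OF 0(2-4)] by (auto simp: Let_def sat_succ_fm)
    have "computes p ls (rank v)"
      by (rule "5.IH"(1)[OF xs U' _ _ sat]) (use fresh(1) in \<open>auto simp: ls_def\<close>)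
    then show ?case using 0(1) by (metis computes.PrimRec_0)
  next
    case (Suc m)
    then obtain j u where ju: "j \<in> universe A" "u \<in> universe A" "[s, j, u] \<in> interp A 1"
      and e: "let e'' = e(k := s, k+1 := i, k+2 := v, k+3 := j, k+4 := u) in
         sat A e'' (succ_fm (k+3) (k+1) (k+5))
         \<and> sat A e'' (graph_fm q ((k+3) # (k+4) # ns) (k+2) (k+5))"
      using just[OF Suc(3-5)] by (auto simp: Let_def sat_zero_fm)
    let ?e = "e(k := s, k+1 := i, k+2 := v, k+3 := j, k+4 := u)"
    have U': "range ?e \<subseteq> universe A" using U s(1) ju Suc by auto
    have "rank i = Suc (rank j)"
      using e ju Suc(3) by (simp add: Let_def sat_succ_fm)
    then have m: "rank j = m" using Suc(2) by simp
    then have "computes (PrimRec p q) (m # ls) (rank u)" using Suc(1)[OF _ ju] by auto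
    moreover have sat: "sat A ?e (graph_fm q ((k+3) # (k+4) # ns) (k+2) (k+5))"
      using e by (simp add: Let_def)
    have "computes q (m # rank u # ls) (rank v)"
      by (rule "5.IH"(2)[OF xs U' _ _ sat]) (use fresh(1) m in \<open>auto simp: ls_def\<close>)
    ultimately show ?case using Suc(2) by (metis computes.PrimRec_Suc)
  qed
  from this[OF U U s(2)] show ?case using 5(7,8) by (simp add: xs ls_def)
next
  case (6 p xs y k)
  have U: "\<And>x. e x \<in> universe A" using 6(3) by auto
  from 6(6) obtain z where z: "z \<in> universe A" "sat A (e(k := z)) (zero_fm k (k+1))"
      "sat A (e(k := z)) (graph_fm p (y # xs) k (k+1))"
    and below: "\<And>m. m \<in> universe A \<Longrightarrow> [m, e y] \<in> interp A 0 \<Longrightarrow>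
      \<exists>w\<in>universe A. (\<exists>v\<in>universe A. [v, w] \<in> interp A 0)
        \<and> sat A (e(k := z, k+1 := m, k+2 := w)) (graph_fm p ((k+1) # xs) (k+2) (k+3))"
    using \<open>y < k\<close> by auto
  have U': "range (e(k := z)) \<subseteq> universe A" using z U by auto
  have "computes p (r # ms) (rank z)"
    by (rule "6.IH"(1)[OF U' _ _ z(3)]) (use 6(4,5,7,8) in auto)
  moreover have "rank z = 0" using z by (simp add: sat_zero_fm)
  moreover have "\<exists>w>0. computes p (m # ms) w" if m: "m < r" for m
  proof -
    \<comment> \<open>Ranks have no gaps, so each \<open>m < r\<close> is the rank of an element and
      the quantifier over the universe reaches all arguments tried before \<open>r\<close>.\<close>
    obtain a where a: "a \<in> universe A" "rank a = m" using below_rank[OF U] m 6(8) by metis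
    then obtain w v where w: "w \<in> universe A" "v \<in> universe A" "[v, w] \<in> interp A 0"
      and sat: "sat A (e(k := z, k+1 := a, k+2 := w)) (graph_fm p ((k+1) # xs) (k+2) (k+3))"
      using below[of a] m U 6(8) by (auto simp: less_iff)
    have U'': "range (e(k := z, k+1 := a, k+2 := w)) \<subseteq> universe A" using z w a U by auto
    have "computes p (m # ms) (rank w)"
      by (rule "6.IH"(2)[OF U'' _ _ sat]) (use 6(4,7) a in auto)
    moreover have "rank w > 0" using w by (simp add: less_iff)
    ultimately show ?thesis by blast
  qed
  ultimately show ?case by (simp add: computes.Mu)
next
  case (7 p zs xs y k)
  have "computes p ls r"
    by (rule "7.IH"[OF 7(2,4,5) _ 7(8,9)]) (use 7(6) in simp)
  then show ?case by simp
next
  case (8 q qs p zs xs y k)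
  have U: "\<And>x. e x \<in> universe A" using 8(3) by auto
  from 8(7) obtain z where z: "z \<in> universe A" "sat A (e(k := z)) (graph_fm q xs k (k+1))"
    "sat A (e(k := z)) (comp_fm qs p (zs @ [k]) xs y (k+1))" by auto
  have U': "range (e(k := z)) \<subseteq> universe A" using z U by auto
  have "computes q ms (rank z)"
    by (rule "8.IH"(1)[OF U' _ _ z(2)]) (use 8(4,8) in auto)
  moreover have "\<exists>ys. list_all2 (\<lambda>q. computes q ms) qs ys \<and> computes p ((ls @ [rank z]) @ ys) r"
    by (rule "8.IH"(2)[OF U' _ _ _ z(3)]) (use 8(4-6,8-10) in auto)
  then obtain ys where "list_all2 (\<lambda>q. computes q ms) qs ys"
      "computes p (ls @ rank z # ys) r"
    by auto
  ultimately show ?case by (intro exI[of _ "rank z # ys"]) auto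
qed

end

section \<open>Standard structures\<close>

text \<open>A table is coded by the number whose binary digits mark its (index, value) pairs.\<close>

definition standard :: "nat \<Rightarrow> nat struct" where
  "standard N = \<lparr>universe = {..<N}, interp = (\<lambda>R.
     if R = 0 then {[i, j] | i j. i < j \<and> j < N}
     else if R = 1 then {[s, i, v] | s i v. s < N \<and> i < N \<and> v < N \<and> prod_encode (i, v) \<in> set_decode s}
     else {})\<rparr>"

lemma universe_standard [simp]: "universe (standard N) = {..<N}"
  by (simp add: standard_def)

lemma interp_standard [simp]:
  "[i, j] \<in> interp (standard N) 0 \<longleftrightarrow> i < j \<and> j < N"
  "[s, i, v] \<in> interp (standard N) (Suc 0)
    \<longleftrightarrow> s < N \<and> i < N \<and> v < N \<and> prod_encode (i, v) \<in> set_decode s"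
  by (auto simp: standard_def)

lemma standard_in_Fin: "N > 0 \<Longrightarrow> standard N \<in> Fin order_sig"
  by (auto simp: Fin_def standard_def order_sig_def split: if_splits)

interpretation standard: ranked "standard N" "\<lambda>x. x"
  by unfold_locales auto

lemma standard_linorder: "sat (standard N) e linorder_fm"
  by (auto simp: sat_linorder_fm)

section \<open>Completeness of graph formulas in large standard structures\<close>

text \<open>Intermediate values and table codes must be elements, so truth is claimed for all large
  \<open>N\<close>; the filter replaces explicit bounds. The threshold is uniform in assignments and
  variable names, since subformulas are used under many of them.\<close>

definition represented :: "prog \<Rightarrow> nat list \<Rightarrow> nat \<Rightarrow> bool" where
  "represented p ms r \<longleftrightarrow> (\<forall>\<^sub>F N in sequentially. \<forall>e xs y k.
     range e \<subseteq> {..<N} \<longrightarrow> (\<forall>x\<in>set xs. x < k) \<longrightarrow> y < k \<longrightarrow> map e xs = ms \<longrightarrow> e y = r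
     \<longrightarrow> sat (standard N) e (graph_fm p xs y k))"

text \<open>The outputs \<open>ys\<close> are the witnesses for the quantifiers of
  \<open>comp_fm\<close>; only finitely many thresholds are combined. The variables
  \<open>zs\<close> already hold the outputs \<open>ls\<close>.\<close>

lemma represented_comp:
  assumes "list_all2 (\<lambda>q. represented q ms) qs ys" "represented p (ls @ ys) r"
  shows "\<forall>\<^sub>F N in sequentially. \<forall>e xs zs y k.
     range e \<subseteq> {..<N} \<longrightarrow> (\<forall>x\<in>set xs. x < k) \<longrightarrow> (\<forall>x\<in>set zs. x < k) \<longrightarrow> y < k
     \<longrightarrow> map e xs = ms \<longrightarrow> map e zs = ls \<longrightarrow> e y = r
     \<longrightarrow> sat (standard N) e (comp_fm qs p zs xs y k)"
  using assms
proof (induction qs arbitrary: ys ls)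
  case Nil
  then have "represented p ls r" by simp
  then show ?case unfolding represented_def by eventually_elim simp
next
  case (Cons q qs)
  then obtain v vs where ys: "ys = v # vs" by (cases ys) auto
  with Cons.prems have q: "represented q ms v" and "list_all2 (\<lambda>q. represented q ms) qs vs"
    "represented p ((ls @ [v]) @ vs) r" by auto
  from Cons.IH[OF this(2,3)] q[unfolded represented_def] eventually_gt_at_top[of v]
  show ?case
  proof eventually_elim
    case (elim N)
    show ?case
    proof (intro allI impI)
      fix e :: "nat \<Rightarrow> nat" and xs zs y k
      assume e: "range e \<subseteq> {..<N}" "\<forall>x\<in>set xs. x < k" "\<forall>x\<in>set zs. x < k" "y < k"
        "map e xs = ms" "map e zs = ls" "e y = r"
      have U: "range (e(k := v)) \<subseteq> {..<N}" using e(1) elim(3) by auto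
      have "sat (standard N) (e(k := v)) (graph_fm q xs k (k+1))"
        by (rule elim(2)[rule_format, OF U]) (use e in auto)
      moreover have "sat (standard N) (e(k := v)) (comp_fm qs p (zs @ [k]) xs y (k+1))"
        by (rule elim(1)[rule_format, OF U]) (use e in auto)
      ultimately show "sat (standard N) e (comp_fm (q # qs) p zs xs y k)"
        using elim(3) by auto
    qed
  qed
qed

text \<open>The function \<open>f\<close> lists the intermediate values of the recursion; its
  restriction to \<open>{..n}\<close> will be the table.\<close>

lemma PrimRec_trace:
  assumes "computes (PrimRec p q) (n # ls) r"
  obtains f where "f n = r" "computes p ls (f 0)" "\<And>i. i < n \<Longrightarrow> computes q (i # f i # ls) (f (Suc i))"
proof -
  have "\<exists>f. f n = r \<and> computes p ls (f 0) \<and> (\<forall>i<n. computes q (i # f i # ls) (f (Suc i)))"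
    using assms
  proof (induction n arbitrary: r)
    case 0
    then have "computes p ls r" by (cases rule: computes.cases) auto
    then show ?case by (intro exI[of _ "\<lambda>_. r"]) simp
  next
    case (Suc n)
    from Suc.prems obtain v
      where v: "computes (PrimRec p q) (n # ls) v" "computes q (n # v # ls) r"
      by (cases rule: computes.cases) auto
    from Suc.IH[OF v(1)] obtain f where
      "f n = v" "computes p ls (f 0)" "\<forall>i<n. computes q (i # f i # ls) (f (Suc i))" by blast
    then show ?case using v(2) by (intro exI[of _ "f(Suc n := r)"]) (auto simp: less_Suc_eq)
  qed
  then show thesis using that by blast
qed

text \<open>A halting computation has finitely many immediate subcomputations, so their thresholds
  from the induction hypotheses can be combined with bounds on the values that occur.\<close>

lemma graph_fm_complete: "computes p ms r \<Longrightarrow> represented p ms r"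
proof (induction p arbitrary: ms r)
  case Zero
  then have "r = 0" by (cases rule: computes.cases) auto
  then have "sat (standard N) e (graph_fm Zero xs y k)"
    if "range e \<subseteq> {..<N}" "y < k" "e y = r" for N e xs y k
    using that standard.sat_zero_fm[of e y N k] by (auto simp: image_subset_iff)
  then show ?case unfolding represented_def by (simp add: always_eventually)
next
  case Succ
  then obtain m where m: "ms = [m]" "r = Suc m" by (cases rule: computes.cases) auto
  have "sat (standard N) e (graph_fm Succ xs y k)"
    if e: "range e \<subseteq> {..<N}" "\<forall>x\<in>set xs. x < k" "y < k" "map e xs = ms" "e y = r" for N e xs y k
  proof -
    obtain x where x: "xs = [x]" "e x = m" using e(4) m(1) by auto
    have "e x < N" "e y < N" using e(1) by auto
    then have "sat (standard N) e (succ_fm x y k)"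
      using e(2,3,5) m(2) x by (subst standard.sat_succ_fm) auto
    then show ?thesis by (simp add: x(1))
  qed
  then show ?case unfolding represented_def by (simp add: always_eventually)
next
  case (Proj i)
  then have "i < length ms" "r = ms ! i" by (cases rule: computes.cases; simp)+
  then have "sat (standard N) e (graph_fm (Proj i) xs y k)"
    if "map e xs = ms" "e y = r" for N e xs y k
    using that by auto
  then show ?case unfolding represented_def by (simp add: always_eventually)
next
  case (Comp p qs)
  from Comp.prems obtain ys where ys: "list_all2 (\<lambda>q. computes q ms) qs ys" "computes p ys r"
    by (cases rule: computes.cases) auto
  have "list_all2 (\<lambda>q. represented q ms) qs ys"
    using ys(1) by (rule list.rel_mono_strong) (rule Comp.IH(2))
  moreover have "represented p ([] @ ys) r" using Comp.IH(1) ys(2) by simp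
  ultimately show ?case
    unfolding represented_def[of "Comp p qs"] by (rule eventually_mono[OF represented_comp]) simp
next
  case (PrimRec p q)
  from PrimRec.prems obtain n ls where ms: "ms = n # ls" by (cases rule: computes.cases) auto
  obtain f where f: "f n = r" "computes p ls (f 0)"
      "\<And>i. i < n \<Longrightarrow> computes q (i # f i # ls) (f (Suc i))"
    using PrimRec_trace PrimRec.prems unfolding ms by blast
  \<comment> \<open>The witness for the table variable: the code of exactly the pairs
    \<open>(i, f i)\<close> with \<open>i\<close> at most \<open>n\<close>.\<close>
  define s where "s = set_encode ((\<lambda>i. prod_encode (i, f i)) ` {..n})"
  have s: "prod_encode (i, v) \<in> set_decode s \<longleftrightarrow> i \<le> n \<and> v = f i" for i v
    by (auto simp: s_def)
  have "\<forall>\<^sub>F N in sequentially. \<forall>i\<in>{..n}. f i < N"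
    by (intro eventually_ball_finite ballI eventually_gt_at_top) simp
  moreover have "\<forall>\<^sub>F N in sequentially. \<forall>i\<in>{..<n}. \<forall>e xs y k.
     range e \<subseteq> {..<N} \<longrightarrow> (\<forall>x\<in>set xs. x < k) \<longrightarrow> y < k \<longrightarrow> map e xs = i # f i # ls \<longrightarrow> e y = f (Suc i)
     \<longrightarrow> sat (standard N) e (graph_fm q xs y k)"
    using PrimRec.IH(2)[OF f(3), unfolded represented_def]
    by (intro eventually_ball_finite ballI) auto
  moreover note PrimRec.IH(1)[OF f(2), unfolded represented_def]
    eventually_gt_at_top[of n] eventually_gt_at_top[of s]
  ultimately show ?case unfolding represented_def
  proof eventually_elim
    case (elim N)
    show ?case
    proof (intro allI impI)
      fix e :: "nat \<Rightarrow> nat" and xs y k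
      assume e: "range e \<subseteq> {..<N}" "\<forall>x\<in>set xs. x < k" "y < k" "map e xs = ms" "e y = r"
      obtain a as where xs: "xs = a # as" "e a = n" "map e as = ls" using e(4) ms by auto
      have fresh: "k \<notin> set as" "Suc k \<notin> set as" "Suc (Suc k) \<notin> set as"
          "k + 3 \<notin> set as" "k + 4 \<notin> set as"
        using e(2) xs(1) by fastforce+
      have eN: "e x < N" for x using e(1) by auto
      \<comment> \<open>Under \<open>?e i\<close> the variables \<open>k+1\<close> and
        \<open>k+2\<close> describe entry \<open>i\<close>; under \<open>?e' i\<close> they describe
        entry \<open>Suc i\<close>, and \<open>k+3\<close> and \<open>k+4\<close> its
        predecessor.\<close>
      let ?e = "\<lambda>i. e(k := s, k+1 := i, k+2 := f i)"
      let ?e' = "\<lambda>i. e(k := s, k+1 := Suc i, k+2 := f (Suc i), k+3 := i, k+4 := f i)"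
      have base: "sat (standard N) (?e 0) (zero_fm (k+1) (k+3))"
          "sat (standard N) (?e 0) (graph_fm p as (k+2) (k+3))"
      proof -
        have U: "range (?e 0) \<subseteq> {..<N}" using eN elim by auto
        show "sat (standard N) (?e 0) (zero_fm (k+1) (k+3))"
          using elim by (subst standard.sat_zero_fm) auto
        show "sat (standard N) (?e 0) (graph_fm p as (k+2) (k+3))"
          by (rule elim(3)[rule_format, OF U]) (use e(2) fresh xs in auto)
      qed
      have step: "sat (standard N) (?e' i) (succ_fm (k+3) (k+1) (k+5))"
          "sat (standard N) (?e' i) (graph_fm q ((k+3) # (k+4) # as) (k+2) (k+5))" if "i < n" for i
      proof -
        have U: "range (?e' i) \<subseteq> {..<N}" using eN elim that by auto
        show "sat (standard N) (?e' i) (succ_fm (k+3) (k+1) (k+5))"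
          using elim that by (subst standard.sat_succ_fm) auto
        show "sat (standard N) (?e' i) (graph_fm q ((k+3) # (k+4) # as) (k+2) (k+5))"
          by (rule elim(2)[rule_format, OF _ U]) (use e(2) fresh xs that in auto)
      qed
      define \<psi> where "\<psi> = disj_fm (Conj (zero_fm (k+1) (k+3)) (graph_fm p as (k+2) (k+3)))
         (Ex (k+3) (Ex (k+4) (Conj (succ_fm (k+3) (k+1) (k+5))
           (Conj (entry_fm k (k+3) (k+4)) (graph_fm q ((k+3) # (k+4) # as) (k+2) (k+5))))))"
      have \<psi>: "sat (standard N) (?e i) \<psi>" if "i \<le> n" for i
      proof (cases i)
        case 0
        then show ?thesis using base by (simp add: \<psi>_def)
      next
        case (Suc j)
        have "sat (standard N) (?e' j) (entry_fm k (k+3) (k+4))"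
          using elim that Suc by (auto simp: s)
        moreover have "j < N" "f j < N" using elim(1,4) that Suc by auto
        ultimately have "\<exists>j\<in>{..<N}. \<exists>u\<in>{..<N}.
          sat (standard N) ((?e i)(k+3 := j, k+4 := u)) (Conj (succ_fm (k+3) (k+1) (k+5))
           (Conj (entry_fm k (k+3) (k+4)) (graph_fm q ((k+3) # (k+4) # as) (k+2) (k+5))))"
          using step[of j] that unfolding Suc
          by (intro bexI[of _ j] bexI[of _ "f j"]) simp_all
        then show ?thesis by (simp add: \<psi>_def)
      qed
      \<comment> \<open>A pair outside the table satisfies the implication vacuously; a pair in it
        has \<open>v = f i\<close> with \<open>i\<close> at most \<open>n\<close>.\<close>
      have "sat (standard N) (e(k := s, k+1 := i, k+2 := v)) (imp_fm (entry_fm k (k+1) (k+2)) \<psi>)" for i v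
        using \<psi>[of i] by (auto simp: s)
      moreover have "sat (standard N) (e(k := s)) (entry_fm k a y)"
        using elim eN e(2,3,5) xs f(1) by (auto simp: s)
      moreover have "graph_fm (PrimRec p q) xs y k = Ex k (Conj (entry_fm k a y)
          (all_fm (k+1) (all_fm (k+2) (imp_fm (entry_fm k (k+1) (k+2)) \<psi>))))"
        by (simp add: xs(1) \<psi>_def)
      ultimately show "sat (standard N) e (graph_fm (PrimRec p q) xs y k)"
        using elim(5) by (auto intro!: bexI[of _ s])
    qed
  qed
next
  case (Mu p)
  from Mu.prems have zero: "computes p (r # ms) 0"
    and pos: "\<forall>m<r. \<exists>v>0. computes p (m # ms) v"
    by (cases rule: computes.cases; simp)+
  from pos obtain g where g: "\<And>m. m < r \<Longrightarrow> g m > 0" "\<And>m. m < r \<Longrightarrow> computes p (m # ms) (g m)"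
    by metis
  have "\<forall>\<^sub>F N in sequentially. \<forall>m\<in>{..<r}. g m < N"
    by (intro eventually_ball_finite ballI eventually_gt_at_top) simp
  moreover have "\<forall>\<^sub>F N in sequentially. \<forall>m\<in>{..<r}. \<forall>e xs y k.
     range e \<subseteq> {..<N} \<longrightarrow> (\<forall>x\<in>set xs. x < k) \<longrightarrow> y < k \<longrightarrow> map e xs = m # ms \<longrightarrow> e y = g m
     \<longrightarrow> sat (standard N) e (graph_fm p xs y k)"
    using Mu.IH[OF g(2), unfolded represented_def]
    by (intro eventually_ball_finite ballI) auto
  moreover note Mu.IH[OF zero, unfolded represented_def]
  ultimately show ?case unfolding represented_def
  proof eventually_elim
    case (elim N)
    show ?case
    proof (intro allI impI)
      fix e :: "nat \<Rightarrow> nat" and xs y k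
      assume e: "range e \<subseteq> {..<N}" "\<forall>x\<in>set xs. x < k" "y < k" "map e xs = ms" "e y = r"
      have eN: "e x < N" for x using e(1) by auto
      have fresh: "k \<notin> set xs" "Suc k \<notin> set xs" "Suc (Suc k) \<notin> set xs"
        using e(2) by fastforce+
      have N: "0 < N" using eN[of 0] by simp
      have U: "range (e(k := 0)) \<subseteq> {..<N}" using eN N by auto
      have "sat (standard N) (e(k := 0)) (zero_fm k (k+1))"
        using N by (subst standard.sat_zero_fm) auto
      moreover have "sat (standard N) (e(k := 0)) (graph_fm p (y # xs) k (k+1))"
        by (rule elim(3)[rule_format, OF U]) (use e in auto)
      moreover have "sat (standard N) (e(k := 0, k+1 := m)) (imp_fm (less_fm (k+1) y)
          (Ex (k+2) (Conj (Ex (k+3) (less_fm (k+3) (k+2))) (graph_fm p ((k+1) # xs) (k+2) (k+3)))))"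
        for m
      proof (cases "m < r")
        case True
        let ?e = "e(k := 0, k+1 := m, k+2 := g m)"
        have gN: "g m < N" using elim(1) True by simp
        have U: "range ?e \<subseteq> {..<N}" using eN N gN True eN[of y] e(5) by auto
        have "sat (standard N) ?e (graph_fm p ((k+1) # xs) (k+2) (k+3))"
          by (rule elim(2)[rule_format, OF _ U]) (use e fresh True in auto)
        moreover have "sat (standard N) ?e (Ex (k+3) (less_fm (k+3) (k+2)))"
          using g(1)[OF True] gN N by auto
        ultimately show ?thesis using gN
          unfolding sat.simps(3-5) by (intro notI) (auto simp del: sat.simps)
      \<comment> \<open>From \<open>r\<close> on, the premise \<open>less_fm (k+1) y\<close>
        fails.\<close>
      qed (use e(3,5) in simp)
      ultimately show "sat (standard N) e (graph_fm (Mu p) xs y k)"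
        using N unfolding graph_fm.simps sat.simps(3-5)
        by (intro bexI[of _ 0] conjI) (simp_all del: sat.simps)
    qed
  qed
qed

section \<open>Diagonalization\<close>

text \<open>\<open>numeral_fm n\<close> has the free variable \<open>n\<close> and says that its value has rank \<open>n\<close>: indexing the
  variable by the numeral keeps the recursion on Goedel numbers simple.\<close>

fun numeral_fm :: "nat \<Rightarrow> fm" where
  "numeral_fm 0 = zero_fm 0 1"
| "numeral_fm (Suc n) = Ex n (Conj (succ_fm n (Suc n) (Suc (Suc n))) (numeral_fm n))"

lemma numeral_fm_over: "fm_over order_sig (numeral_fm n)"
  by (induction n) (simp_all add: zero_fm_def succ_fm_def)

lemma free_vars_numeral_fm: "free_vars (numeral_fm n) \<subseteq> {n}"
  by (induction n) (auto simp: zero_fm_def succ_fm_def)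

text \<open>An element of rank \<open>Suc n\<close> has a predecessor of rank \<open>n\<close>, as
  there are no gaps. In a structure with at most \<open>n\<close> elements both sides are
  false.\<close>

lemma (in ranked) sat_numeral_fm:
  "range e \<subseteq> universe A \<Longrightarrow> sat A e (numeral_fm n) \<longleftrightarrow> rank (e n) = n"
proof (induction n arbitrary: e)
  case 0
  then show ?case by (simp add: sat_zero_fm image_subset_iff)
next
  case (Suc n)
  have U: "e x \<in> universe A" for x using Suc.prems by auto
  have "sat A (e(n := a)) (succ_fm n (Suc n) (Suc (Suc n))) \<longleftrightarrow> rank (e (Suc n)) = Suc (rank a)"
    "sat A (e(n := a)) (numeral_fm n) \<longleftrightarrow> rank a = n" if "a \<in> universe A" for a
  proof -
    show "sat A (e(n := a)) (succ_fm n (Suc n) (Suc (Suc n))) \<longleftrightarrow> rank (e (Suc n)) = Suc (rank a)"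
      using U that by (subst sat_succ_fm) auto
    have "range (e(n := a)) \<subseteq> universe A" using U that by auto
    from Suc.IH[OF this] show "sat A (e(n := a)) (numeral_fm n) \<longleftrightarrow> rank a = n"
      by (simp only: fun_upd_same)
  qed
  then have "sat A e (numeral_fm (Suc n)) \<longleftrightarrow>
      (\<exists>a\<in>universe A. rank (e (Suc n)) = Suc (rank a) \<and> rank a = n)" by simp
  also have "\<dots> \<longleftrightarrow> rank (e (Suc n)) = Suc n"
    using below_rank[OF U, of n "Suc n"] by (metis lessI)
  finally show ?case .
qed

text \<open>Applies \<theta>, as a property of variable 0, to its own code. The quantified equation
  replaces substitution, so \<theta> enters unchanged; \<open>c\<close> is both the code and the
  name of the variable holding it.\<close>

definition diag_fm :: "fm \<Rightarrow> fm" where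
  "diag_fm \<theta> = (let c = fm_encode \<theta> in
     Ex c (Conj (numeral_fm c) (Ex 0 (Conj (Eq 0 c) \<theta>))))"

text \<open>The recursion of \<open>numeral_fm\<close> carries over to codes, with 4 and 3 the tags
  of \<open>Ex\<close> and \<open>Conj\<close>.\<close>

lemma computable_numeral_code: "computable 1 (\<lambda>xs. fm_encode (numeral_fm (xs ! 0)))"
  by (rule computable_primrec1[where g = "\<lambda>n r. prod_encode (4, prod_encode (n,
      prod_encode (3, prod_encode (fm_encode (succ_fm n (Suc n) (Suc (Suc n))), r))))"])
    (auto simp: succ_fm_def intro!: computable_prod_encode computable_const computable_proj
      computable_Suc)

text \<open>The code of \<open>diag_fm\<close> \<theta> is a fixed pairing expression in the code of
  \<theta>, which never has to be decoded.\<close>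

lemma computable_diag:
  "\<exists>q. \<forall>\<theta>. computes q [fm_encode \<theta>] (fm_encode (diag_fm \<theta>))"
proof -
  have "computable 1 (\<lambda>xs. prod_encode (4, prod_encode (xs ! 0, prod_encode (3,
      prod_encode (fm_encode (numeral_fm (xs ! 0)), prod_encode (4, prod_encode (0,
      prod_encode (3, prod_encode (prod_encode (0, prod_encode (0, xs ! 0)), xs ! 0)))))))))"
    by (intro computable_prod_encode computable_const computable_proj computable_numeral_code)
      simp_all
  then obtain q where q: "\<And>xs. length xs = 1 \<Longrightarrow> computes q xs (prod_encode (4, prod_encode (xs ! 0,
      prod_encode (3, prod_encode (fm_encode (numeral_fm (xs ! 0)), prod_encode (4, prod_encode (0,
      prod_encode (3, prod_encode (prod_encode (0, prod_encode (0, xs ! 0)), xs ! 0)))))))))"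
    unfolding computable_def by blast
  have "computes q [fm_encode \<theta>] (fm_encode (diag_fm \<theta>))" for \<theta>
    using q[of "[fm_encode \<theta>]"] by (simp add: diag_fm_def Let_def)
  then show ?thesis by blast
qed

text \<open>The code must be nonzero to keep the variable holding it distinct from variable 0, which
  the inner quantifier rebinds.\<close>

lemma (in ranked) sat_diag_fm:
  assumes "range e \<subseteq> universe A" "fm_encode \<theta> \<noteq> 0"
  shows "sat A e (diag_fm \<theta>) \<longleftrightarrow> (\<exists>a\<in>universe A. rank a = fm_encode \<theta>
    \<and> sat A (e(fm_encode \<theta> := a, 0 := a)) \<theta>)"
proof -
  have "sat A (e(fm_encode \<theta> := a)) (numeral_fm (fm_encode \<theta>)) \<longleftrightarrow> rank a = fm_encode \<theta>"
    if "a \<in> universe A" for a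
    using that assms(1) by (subst sat_numeral_fm) auto
  then show ?thesis using assms(2) by (auto simp: diag_fm_def Let_def)
qed

section \<open>Disjoint unions against linear orders, and the contradiction\<close>

text \<open>No tuple of a disjoint union mixes the two sides, so elements from different sides are
  distinct and incomparable.\<close>

lemma disjoint_union_not_linorder:
  assumes "universe A \<noteq> {}" "universe A' \<noteq> {}"
  shows "\<not> sat (A \<uplus> A') e linorder_fm"
proof -
  obtain a b where "a \<in> universe A" "b \<in> universe A'" using assms by auto
  then have "Inl a \<in> universe (A \<uplus> A')" "Inr b \<in> universe (A \<uplus> A')"
    "[Inl a, Inr b] \<notin> interp (A \<uplus> A') 0" "[Inr b, Inl a] \<notin> interp (A \<uplus> A') 0"
    by (auto simp: disjoint_union_def)
  then show ?thesis unfolding sat_linorder_fm by blast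
qed

lemma sat_diag_linorder:
  "sat A e (diag_fm (Conj linorder_fm \<psi>)) \<Longrightarrow> sat A e linorder_fm"
  by (auto simp: diag_fm_def Let_def sat_linorder_fm)

text \<open>The sentence implies \<open>linorder_fm\<close>, so no disjoint union satisfies it and
  closure can hold only vacuously.\<close>

lemma closed_iff_no_finite_model:
  "closed_under_disjoint_unions \<sigma> (diag_fm (Conj linorder_fm \<psi>)) \<longleftrightarrow>
    (\<forall>A :: nat struct \<in> Fin \<sigma>. \<not> A \<Turnstile> diag_fm (Conj linorder_fm \<psi>))"
proof -
  let ?\<phi> = "diag_fm (Conj linorder_fm \<psi>)"
  have "\<not> A \<uplus> A' \<Turnstile> ?\<phi>" if "A \<in> Fin \<sigma>" "A' \<in> Fin \<sigma>" for A A' :: "nat struct"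
  proof -
    have "universe (A \<uplus> A') \<noteq> {}"
      using that by (simp add: Fin_def disjoint_union_def)
    then obtain a where "a \<in> universe (A \<uplus> A')" by blast
    then have "range (\<lambda>_. a) \<subseteq> universe (A \<uplus> A')" by auto
    moreover have "\<not> sat (A \<uplus> A') (\<lambda>_. a) ?\<phi>"
      using sat_diag_linorder[of "A \<uplus> A'" _ \<psi>] disjoint_union_not_linorder[of A A'] that
      by (auto simp: Fin_def)
    ultimately show ?thesis unfolding models_def by blast
  qed
  then show ?thesis unfolding closed_under_disjoint_unions_def by blast
qed

theorem theorem5p14:
  "\<exists>\<sigma>. finite_signature \<sigma> \<and>
     \<not> (\<exists>p. decides p (sentences \<sigma>) (closed_under_disjoint_unions \<sigma>))"
proof (intro exI[of _ order_sig] conjI notI)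
  show "finite_signature order_sig"
    by (auto simp: finite_signature_def order_sig_def ran_def split: if_splits)
next
  assume "\<exists>p. decides p (sentences order_sig) (closed_under_disjoint_unions order_sig)"
  then obtain p where p: "decides p (sentences order_sig) (closed_under_disjoint_unions order_sig)" ..
  obtain q where q: "\<And>\<theta>. computes q [fm_encode \<theta>] (fm_encode (diag_fm \<theta>))"
    using computable_diag by blast
  \<comment> \<open>On the code of a formula, \<open>d\<close> returns the verdict of
    \<open>p\<close> on its diagonalization.\<close>
  define d where "d = Comp p [q]"
  \<comment> \<open>Says that \<open>d\<close> halts on the value of variable 0 with an output that
    has something below it, that is, a positive one.\<close>
  define \<psi> where "\<psi> = Ex 1 (Conj (Ex 2 (less_fm 2 1)) (graph_fm d [0] 1 2))"
  define \<theta> where "\<theta> = Conj linorder_fm \<psi>"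
  define c where "c = fm_encode \<theta>"
  let ?closed = "closed_under_disjoint_unions order_sig (diag_fm \<theta>)"
  have c: "c \<noteq> 0" by (simp add: c_def \<theta>_def prod_encode_def)
  have free: "free_vars linorder_fm = {}" "free_vars \<psi> \<subseteq> {0}"
    using free_vars_graph_fm(1)[of d "[0]" 1 2] by (auto simp: linorder_fm_def \<psi>_def)
  \<comment> \<open>\<open>decides\<close> binds \<open>p\<close> on sentences only, so the diagonal
    formula is first shown to be one.\<close>
  have "fm_over order_sig (diag_fm \<theta>)"
    by (simp add: diag_fm_def \<theta>_def \<psi>_def linorder_fm_def numeral_fm_over graph_fm_over Let_def)
  moreover have "free_vars (diag_fm \<theta>) = {}"
    using free free_vars_numeral_fm[of c] by (auto simp: diag_fm_def \<theta>_def c_def Let_def)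
  ultimately have "computes p [fm_encode (diag_fm \<theta>)] (if ?closed then 1 else 0)"
    using p by (simp add: decides_def sentences_def)
  then have d: "computes d [c] (if ?closed then 1 else 0)"
    using q unfolding d_def c_def
    by (auto intro!: computes.Comp[of _ _ "[fm_encode (diag_fm \<theta>)]"])
  show False
  proof (cases ?closed)
    case True
    \<comment> \<open>Here \<open>d\<close> returns 1 on \<open>c\<close>; a large standard
      structure recognises this and becomes a forbidden model.\<close>
    have "\<forall>\<^sub>F N in sequentially. \<forall>e xs y k.
      range e \<subseteq> {..<N} \<longrightarrow> (\<forall>x\<in>set xs. x < k) \<longrightarrow> y < k \<longrightarrow> map e xs = [c] \<longrightarrow> e y = 1
      \<longrightarrow> sat (standard N) e (graph_fm d xs y k)"
      using graph_fm_complete[OF d] True by (simp add: represented_def)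
    then have "\<forall>\<^sub>F N in sequentially. N > 1 \<and> N > c \<and> (\<forall>e xs y k.
      range e \<subseteq> {..<N} \<longrightarrow> (\<forall>x\<in>set xs. x < k) \<longrightarrow> y < k \<longrightarrow> map e xs = [c] \<longrightarrow> e y = 1
      \<longrightarrow> sat (standard N) e (graph_fm d xs y k))"
      by (intro eventually_conj eventually_gt_at_top)
    from eventually_happens'[OF sequentially_bot this] obtain N where N: "N > 1" "N > c"
      and sat: "\<And>e xs y k. range e \<subseteq> {..<N} \<Longrightarrow> \<forall>x\<in>set xs. x < k
        \<Longrightarrow> y < k \<Longrightarrow> map e xs = [c] \<Longrightarrow> e y = 1 \<Longrightarrow> sat (standard N) e (graph_fm d xs y k)"
      by blast
    have "sat (standard N) e (diag_fm \<theta>)" if e: "range e \<subseteq> {..<N}" for e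
    proof -
      \<comment> \<open>The variables \<open>c\<close> and 0 receive the number \<open>c\<close>,
        and variable 1 the output 1, whose positivity is witnessed by 0.\<close>
      let ?e = "e(c := c, 0 := c, 1 := 1)"
      have "range ?e \<subseteq> {..<N}" using e N by auto
      from sat[OF this] have "sat (standard N) ?e (graph_fm d [0] 1 2)" by auto
      then have "sat (standard N) (e(c := c, 0 := c)) \<psi>"
        using N unfolding \<psi>_def sat.simps(4,5)
        by (intro bexI[of _ 1] conjI bexI[of _ 0]) auto
      then show ?thesis using e N c standard_linorder
        unfolding c_def by (subst standard.sat_diag_fm) (auto simp: \<theta>_def)
    qed
    then have "standard N \<Turnstile> diag_fm \<theta>" by (simp add: models_def)
    then show False
      using True N standard_in_Fin[of N] closed_iff_no_finite_model unfolding \<theta>_def by auto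
  next
    case False
    \<comment> \<open>Here \<open>d\<close> returns 0 on \<open>c\<close>, yet some finite model
      asserts a positive output, and soundness makes that assertion true.\<close>
    then obtain A :: "nat struct" where A: "A \<in> Fin order_sig" "A \<Turnstile> diag_fm \<theta>"
      using closed_iff_no_finite_model unfolding \<theta>_def by blast
    then obtain a0 where "a0 \<in> universe A" by (auto simp: Fin_def)
    then have e0: "range (\<lambda>_::nat. a0) \<subseteq> universe A" by auto
    then have sat: "sat A (\<lambda>_. a0) (diag_fm \<theta>)" using A(2) by (auto simp: models_def)
    have "finite (universe A)" using A(1) by (simp add: Fin_def)
    then obtain rank where "ranked A rank"
      using ranked_linorder sat_diag_linorder sat unfolding \<theta>_def by metis
    then interpret ranked A rank .
    from sat obtain a where a: "a \<in> universe A" "rank a = c"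
        "sat A ((\<lambda>_. a0)(c := a, 0 := a)) \<theta>"
      using sat_diag_fm[OF e0, of \<theta>] c unfolding c_def by blast
    then obtain b z where b: "b \<in> universe A" "z \<in> universe A" "[z, b] \<in> interp A 0"
        "sat A ((\<lambda>_. a0)(c := a, 0 := a, 1 := b)) (graph_fm d [0] 1 2)"
      by (auto simp: \<theta>_def \<psi>_def)
    have U: "range ((\<lambda>_. a0)(c := a, 0 := a, 1 := b)) \<subseteq> universe A"
      using a b \<open>a0 \<in> universe A\<close> by auto
    have "computes d [c] (rank b)"
      by (rule graph_fm_sound(1)[OF U _ _ b(4)]) (use a in auto)
    then have "rank b = 0" using computes_deterministic d False by auto
    then show False using b by (simp add: less_iff)
  qed
qed

end
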